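(* Let $G$ and $H$ be finite connected multigraphs such that $H$ fractionally tiles $G$. Then $$\tau(G)^{1/|G|}\ge \tau(H)^{1/|H|}.$$
   Context: $\tau(K)$ is the number of spanning trees of a finite connected multigraph $K$; $|K|$ is its number of vertices. A copy of $H$ in $G$ is a subgraph of $G$ isomorphic to $H$. $H$ fractionally tiles $G$ means there is a finite (nonempty) list of copies of $H$ in $G$ (repetitions allowed) such that every vertex of $G$ is covered by the same number of copies in the list. *)

theory Defs
  imports Complex_Main
begin

text \<open>Finite multigraphs (loops and parallel edges allowed). Each edge e has a set of
  endpoints ends e, which is a one-element set (loop) or a two-element set.\<close>

record ('v, 'e) mgraph =
  verts :: "'v set"
  edges :: "'e set"
  ends  :: "'e \<Rightarrow> 'v set"

definition finite_mgraph :: "('v, 'e) mgraph \<Rightarrow> bool" where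
  "finite_mgraph G \<longleftrightarrow> finite (verts G) \<and> finite (edges G) \<and>
     (\<forall>e \<in> edges G. ends G e \<subseteq> verts G \<and> ends G e \<noteq> {} \<and> card (ends G e) \<le> 2)"

definition adj_in :: "('v, 'e) mgraph \<Rightarrow> 'e set \<Rightarrow> 'v \<Rightarrow> 'v \<Rightarrow> bool" where
  "adj_in G F u v \<longleftrightarrow> (\<exists>e \<in> F. u \<in> ends G e \<and> v \<in> ends G e)"

definition connected_with :: "('v, 'e) mgraph \<Rightarrow> 'e set \<Rightarrow> bool" where
  "connected_with G F \<longleftrightarrow> verts G \<noteq> {} \<and>
     (\<forall>u \<in> verts G. \<forall>v \<in> verts G. (adj_in G F)\<^sup>*\<^sup>* u v)"

definition connected_mgraph :: "('v, 'e) mgraph \<Rightarrow> bool" where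
  "connected_mgraph G \<longleftrightarrow> finite_mgraph G \<and> connected_with G (edges G)"

definition spanning_tree :: "('v, 'e) mgraph \<Rightarrow> 'e set \<Rightarrow> bool" where
  "spanning_tree G T \<longleftrightarrow> T \<subseteq> edges G \<and> connected_with G T \<and>
     (\<forall>e \<in> T. \<not> connected_with G (T - {e}))"

definition tau :: "('v, 'e) mgraph \<Rightarrow> nat" where
  "tau G = card {T. spanning_tree G T}"

definition is_copy :: "('w, 'f) mgraph \<Rightarrow> ('v, 'e) mgraph \<Rightarrow> ('w \<Rightarrow> 'v) \<Rightarrow> ('f \<Rightarrow> 'e) \<Rightarrow> bool" where
  "is_copy H G \<phi> \<psi> \<longleftrightarrow>
     inj_on \<phi> (verts H) \<and> \<phi> ` verts H \<subseteq> verts G \<and>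
     inj_on \<psi> (edges H) \<and> \<psi> ` edges H \<subseteq> edges G \<and>
     (\<forall>e \<in> edges H. ends G (\<psi> e) = \<phi> ` ends H e)"

definition fractionally_tiles :: "('w, 'f) mgraph \<Rightarrow> ('v, 'e) mgraph \<Rightarrow> bool" where
  "fractionally_tiles H G \<longleftrightarrow>
     (\<exists>cs :: (('w \<Rightarrow> 'v) \<times> ('f \<Rightarrow> 'e)) list.
        cs \<noteq> [] \<and> (\<forall>(\<phi>, \<psi>) \<in> set cs. is_copy H G \<phi> \<psi>) \<and>
        (\<exists>c. \<forall>v \<in> verts G. length (filter (\<lambda>(\<phi>, \<psi>). v \<in> \<phi> ` verts H) cs) = c))"

end

theory Submission
  imports Defs "HOL-Analysis.Convex"
begin

text \<open>
  For a set A of vertices let P(A) be the number of spanning forests of G rooted at A, so that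
  P({r}) = tau G and P(V) = 1. If v is not in A, then P(A) / P(A + v) is the effective conductance
  between v and A. By the Dirichlet principle it does not decrease when one passes from H, with the
  smaller root set A \<inter> V(H), to a graph G containing H; and it is at least 1 if v is adjacent to A.
  Let the root set shrink from V to a single vertex, always removing a vertex adjacent to what
  remains (possible as G is connected), and follow this in all copies of H at once. The removal of v
  affects exactly the c copies containing v. In each of them, P changes by a factor of at most that
  for G; in a copy in which v was the last remaining root the factor is 1, which is harmless by
  adjacency. Hence for m copies tau H ^ m \<le> tau G ^ c, and c |G| = m |H| by double counting.
\<close>

section \<open>Rooted forests as parent functions\<close>

text \<open>An edge is read from a chosen end \<open>w\<close>, and parallel edges stay distinct. A
  loop at \<open>w\<close> yields the single dart \<open>(e, w)\<close>: acyclicity keeps it out of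
  forests, and its voltage difference is zero.\<close>

definition darts :: "('v, 'e) mgraph \<Rightarrow> 'v \<Rightarrow> ('e \<times> 'v) set" where
  "darts G w = {(e, u). e \<in> edges G \<and> ends G e = {w, u}}"

text \<open>The edges are forgotten: cycles and reachable roots depend on the vertices
  alone.\<close>

definition arcs :: "('v \<Rightarrow> 'e \<times> 'v) \<Rightarrow> 'v set \<Rightarrow> ('v \<times> 'v) set" where
  "arcs p B = (\<lambda>w. (w, snd (p w))) ` B"

text \<open>A spanning forest rooted at A is encoded by its parent function: each vertex outside A is
  sent to its parent together with the edge leading there.\<close>

definition forests :: "('v, 'e) mgraph \<Rightarrow> 'v set \<Rightarrow> ('v \<Rightarrow> 'e \<times> 'v) set" where
  "forests G A = {p \<in> PiE (verts G - A) (darts G). acyclic (arcs p (verts G - A))}"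

lemma darts_in_verts:
  assumes "finite_mgraph G" "d \<in> darts G w"
  shows "w \<in> verts G" "snd d \<in> verts G"
  using assms by (auto simp: darts_def finite_mgraph_def)

lemma finite_darts:
  assumes "finite_mgraph G"
  shows "finite (darts G w)"
proof (rule finite_subset)
  show "darts G w \<subseteq> edges G \<times> verts G"
    using assms by (auto simp: darts_def finite_mgraph_def)
  show "finite (edges G \<times> verts G)"
    using assms by (auto simp: finite_mgraph_def)
qed

lemma finite_forests:
  assumes "finite_mgraph G"
  shows "finite (forests G A)"
  unfolding forests_def
  by (rule finite_subset[of _ "PiE (verts G - A) (darts G)"])
     (use assms in \<open>auto intro!: finite_PiE finite_darts simp: finite_mgraph_def\<close>)

lemma arcs_upd:
  assumes "w \<in> B"
  shows "arcs (g(w := d)) B = insert (w, snd d) (arcs g (B - {w}))"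
  using assms by (auto simp: arcs_def image_iff)

lemma single_valued_arcs: "single_valued (arcs p B)"
  by (auto simp: single_valued_def arcs_def)

lemma arcs_rtrancl_root:
  assumes "a \<notin> B" "(a, x) \<in> (arcs p B)\<^sup>*"
  shows "x = a"
  using assms(2,1) by (cases rule: converse_rtranclE) (auto simp: arcs_def)

text \<open>Parents are unique, so of two paths from \<open>u\<close> one continues the other; no
  arc leaves a root.\<close>

lemma arcs_roots_unique:
  assumes "(u, a) \<in> (arcs p B)\<^sup>*" "(u, b) \<in> (arcs p B)\<^sup>*" "a \<notin> B" "b \<notin> B"
  shows "a = b"
  using single_valued_confluent[OF single_valued_arcs assms(1,2)] assms(3,4)
    arcs_rtrancl_root by metis

text \<open>Erasing the parent of \<open>w\<close> turns a forest rooted at \<open>A\<close> into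
  one rooted at \<open>insert w A\<close>. Conversely, a dart at \<open>w\<close> may be added
  exactly when its head lies outside the tree of \<open>w\<close>, as otherwise a cycle would
  close.\<close>

lemma sum_forests:
  fixes G :: "('v, 'e) mgraph" and f :: "_ \<Rightarrow> real"
  assumes fin: "finite_mgraph G" and w: "w \<in> verts G" "w \<notin> A"
  shows "(\<Sum>p\<in>forests G A. f p) =
    (\<Sum>g\<in>forests G (insert w A).
       \<Sum>d\<in>{d \<in> darts G w. (snd d, w) \<notin> (arcs g (verts G - insert w A))\<^sup>*}. f (g(w := d)))"
proof -
  define B where "B = verts G - insert w A"
  define D where "D = (\<lambda>g :: 'v \<Rightarrow> 'e \<times> 'v. {d \<in> darts G w. (snd d, w) \<notin> (arcs g B)\<^sup>*})"
  have B: "verts G - A = insert w B" "w \<notin> B" using w by (auto simp: B_def)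
  have ac: "acyclic (arcs (g(w := d)) (insert w B)) \<longleftrightarrow>
      acyclic (arcs g B) \<and> (snd d, w) \<notin> (arcs g B)\<^sup>*" for g :: "'v \<Rightarrow> 'e \<times> 'v" and d
    using B(2) by (simp add: arcs_upd acyclic_insert)
  have fo: "p \<in> forests G A \<longleftrightarrow> (\<exists>g d. p = g(w := d) \<and> g \<in> forests G (insert w A) \<and> d \<in> D g)" for p
  proof -
    have "p \<in> forests G A \<longleftrightarrow> p \<in> (\<lambda>(d, g). g(w := d)) ` (darts G w \<times> PiE B (darts G))
        \<and> acyclic (arcs p (insert w B))"
      by (simp only: forests_def B(1) PiE_insert_eq mem_Collect_eq)
    also have "\<dots> \<longleftrightarrow> (\<exists>g d. p = g(w := d) \<and> (g \<in> PiE B (darts G) \<and> acyclic (arcs g B)) \<and> d \<in> D g)"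
      (is "?L \<longleftrightarrow> ?R")
    proof
      assume L: ?L
      then obtain d g where p: "p = g(w := d)" and dg: "d \<in> darts G w" "g \<in> PiE B (darts G)"
        by clarsimp
      from L have "acyclic (arcs g B) \<and> (snd d, w) \<notin> (arcs g B)\<^sup>*"
        unfolding p using ac[of g d] by simp
      with p dg show ?R by (intro exI[of _ g] exI[of _ d]) (simp add: D_def)
    next
      assume ?R
      then obtain g d where "p = g(w := d)" "g \<in> PiE B (darts G)" "acyclic (arcs g B)" "d \<in> D g"
        by blast
      moreover from this have "(d, g) \<in> darts G w \<times> PiE B (darts G)" by (simp add: D_def)
      then have "g(w := d) \<in> (\<lambda>(d, g). g(w := d)) ` (darts G w \<times> PiE B (darts G))"
        by (rule rev_image_eqI) simp
      ultimately show ?L using ac[of g d] by (simp add: D_def)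
    qed
    finally show ?thesis
      by (simp only: forests_def B_def mem_Collect_eq)
  qed
  have "inj_on (\<lambda>(g, d). g(w := d)) (Sigma (forests G (insert w A)) D)"
  proof (rule inj_onI, clarify)
    fix g d g' d'
    assume g: "g \<in> forests G (insert w A)" "g' \<in> forests G (insert w A)"
      and eq: "g(w := d) = g'(w := d')"
    \<comment> \<open>Members of \<open>PiE\<close> are \<open>undefined\<close> off their domain,
      so \<open>g\<close> can be recovered from \<open>g(w := d)\<close>.\<close>
    have gw: "g w = undefined" "g' w = undefined"
      using g by (auto simp: forests_def)
    have "g = (g(w := d))(w := undefined)" using gw by auto
    also have "\<dots> = g'" unfolding eq using gw by auto
    finally show "g = g' \<and> d = d'" using fun_cong[OF eq, of w] by simp
  qed
  moreover have "forests G A = (\<lambda>(g, d). g(w := d)) ` Sigma (forests G (insert w A)) D"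
  proof (intro equalityI subsetI)
    fix p assume "p \<in> forests G A"
    then obtain g d where "p = g(w := d)" "(g, d) \<in> Sigma (forests G (insert w A)) D"
      unfolding fo by (elim exE conjE) simp
    then show "p \<in> (\<lambda>(g, d). g(w := d)) ` Sigma (forests G (insert w A)) D"
      by (intro rev_image_eqI[of "(g, d)"]) auto
  next
    fix p assume "p \<in> (\<lambda>(g, d). g(w := d)) ` Sigma (forests G (insert w A)) D"
    then obtain g d where gd: "p = g(w := d)" "g \<in> forests G (insert w A)" "d \<in> D g"
      by (elim imageE SigmaE) simp
    show "p \<in> forests G A"
      unfolding fo by (intro exI[of _ g] exI[of _ d] conjI gd)
  qed
  ultimately have "(\<Sum>p\<in>forests G A. f p) = (\<Sum>(g, d)\<in>Sigma (forests G (insert w A)) D. f (g(w := d)))"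
    by (simp add: sum.reindex case_prod_unfold)
  also have "\<dots> = (\<Sum>g\<in>forests G (insert w A). \<Sum>d\<in>D g. f (g(w := d)))"
    by (rule sum.Sigma[symmetric]) (auto simp: finite_forests fin D_def finite_darts)
  finally show ?thesis unfolding D_def B_def .
qed

section \<open>Voltages as forest counts\<close>

text \<open>Up to the factor card (forests G A) this is the voltage at u when v has voltage 1 and the other vertices of A
  are grounded.\<close>

definition attached :: "('v, 'e) mgraph \<Rightarrow> 'v set \<Rightarrow> 'v \<Rightarrow> 'v \<Rightarrow> real" where
  "attached G A v u = (\<Sum>p\<in>forests G A. of_bool ((u, v) \<in> (arcs p (verts G - A))\<^sup>*))"

definition laplacian :: "('v, 'e) mgraph \<Rightarrow> ('v \<Rightarrow> real) \<Rightarrow> 'v \<Rightarrow> real" where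
  "laplacian G x w = (\<Sum>d\<in>darts G w. x w - x (snd d))"

lemma attached_self: "attached G A v v = card (forests G A)"
  by (simp add: attached_def)

lemma attached_other_root:
  fixes G :: "('v, 'e) mgraph"
  assumes "a \<in> A" "a \<noteq> v"
  shows "attached G A v a = 0"
proof -
  have "(a, v) \<notin> (arcs p (verts G - A))\<^sup>*" for p :: "'v \<Rightarrow> 'e \<times> 'v"
    using arcs_rtrancl_root[of a "verts G - A" v p] assms by auto
  then show ?thesis by (simp add: attached_def)
qed

text \<open>The current leaving \<open>v\<close> counts pairs of a forest \<open>g\<close> rooted at
  \<open>insert v A\<close> and a dart at \<open>v\<close> leading out of the tree of
  \<open>v\<close>. By \<open>sum_forests\<close> these pairs are the forests rooted at
  \<open>A\<close>.\<close>

lemma laplacian_attached_self: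
  fixes G :: "('v, 'e) mgraph"
  assumes fin: "finite_mgraph G" and v: "v \<in> verts G" "v \<notin> A"
  shows "laplacian G (attached G (insert v A) v) v = card (forests G A)"
proof -
  define R where "R = (\<lambda>g :: 'v \<Rightarrow> 'e \<times> 'v. (arcs g (verts G - insert v A))\<^sup>*)"
  have "real (card (forests G A)) = (\<Sum>p\<in>forests G A. 1)" by simp
  also have "\<dots> = (\<Sum>g\<in>forests G (insert v A). \<Sum>d\<in>{d \<in> darts G v. (snd d, v) \<notin> R g}. 1)"
    by (subst sum_forests[OF fin v]) (simp add: R_def)
  also have "\<dots> = (\<Sum>g\<in>forests G (insert v A). \<Sum>d\<in>darts G v. 1 - of_bool ((snd d, v) \<in> R g))"
  proof (rule sum.cong[OF refl])
    fix g
    show "(\<Sum>d\<in>{d \<in> darts G v. (snd d, v) \<notin> R g}. 1) =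
        (\<Sum>d\<in>darts G v. 1 - of_bool ((snd d, v) \<in> R g) :: real)"
      by (intro sum.mono_neutral_cong_left) (use fin in \<open>auto simp: finite_darts\<close>)
  qed
  also have "\<dots> = (\<Sum>d\<in>darts G v. \<Sum>g\<in>forests G (insert v A). 1 - of_bool ((snd d, v) \<in> R g))"
    by (rule sum.swap)
  also have "\<dots> = laplacian G (attached G (insert v A) v) v"
    by (simp add: laplacian_def attached_def R_def sum_subtractf)
  finally show ?thesis by simp
qed

text \<open>Harmonicity is checked separately for each forest g rooted at A + w: the terms of all forests
  obtained from g by choosing a parent for w cancel.\<close>

lemma laplacian_attached_other:
  fixes G :: "('v, 'e) mgraph"
  assumes fin: "finite_mgraph G" and w: "w \<in> verts G" "w \<notin> A" and v: "v \<in> A"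
  shows "laplacian G (attached G A v) w = 0"
proof -
  define B where "B = verts G - insert w A"
  define D where "D = darts G w"
  have B: "verts G - A = insert w B" "w \<notin> B" using w by (auto simp: B_def)
  have finD: "finite D" by (simp add: D_def finite_darts fin)
  have "laplacian G (attached G A v) w =
      (\<Sum>p\<in>forests G A. \<Sum>d'\<in>D. of_bool ((w, v) \<in> (arcs p (insert w B))\<^sup>*)
          - of_bool ((snd d', v) \<in> (arcs p (insert w B))\<^sup>*))"
    unfolding laplacian_def attached_def B D_def sum_subtractf[symmetric] by (rule sum.swap)
  also have "\<dots> = (\<Sum>g\<in>forests G (insert w A).
       \<Sum>d\<in>{d \<in> D. (snd d, w) \<notin> (arcs g B)\<^sup>*}. \<Sum>d'\<in>D. 
          of_bool ((w, v) \<in> (insert (w, snd d) (arcs g B))\<^sup>*)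
          - of_bool ((snd d', v) \<in> (insert (w, snd d) (arcs g B))\<^sup>*))"
    by (subst sum_forests[OF fin w]) (simp add: arcs_upd B D_def B_def[symmetric])
  also have "\<dots> = 0"
  proof (rule sum.neutral, rule ballI)
    fix g assume "g \<in> forests G (insert w A)"
    define t where "t = (\<lambda>d :: 'e \<times> 'v. of_bool ((snd d, v) \<in> (arcs g B)\<^sup>*) :: real)"
    define n where "n = (\<lambda>d :: 'e \<times> 'v. of_bool ((snd d, w) \<in> (arcs g B)\<^sup>*) :: real)"
    have vw: "v \<notin> B" "v \<noteq> w" using v w by (auto simp: B_def)
    have disj: "\<not> ((u, v) \<in> (arcs g B)\<^sup>* \<and> (u, w) \<in> (arcs g B)\<^sup>*)" for u
      using arcs_roots_unique[of u v g B w] vw B by auto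
    have wv: "(w, v) \<notin> (arcs g B)\<^sup>*"
      using arcs_rtrancl_root[OF B(2), of v g] vw by auto
    have nt: "(1 - n d) * t d = t d" for d
      using disj[of "snd d"] by (auto simp: n_def t_def)
    \<comment> \<open>Once \<open>w\<close> has parent \<open>snd d\<close>, a vertex reaches
      \<open>v\<close> either as before or through \<open>w\<close>. The latter means that it lay in
      the tree of \<open>w\<close> and that \<open>d\<close> leads into the tree of
      \<open>v\<close>. By \<open>disj\<close> the two cases exclude each other, so their indicators
      add up.\<close>
    have "(\<Sum>d\<in>{d \<in> D. (snd d, w) \<notin> (arcs g B)\<^sup>*}. \<Sum>d'\<in>D. 
          of_bool ((w, v) \<in> (insert (w, snd d) (arcs g B))\<^sup>*)
          - of_bool ((snd d', v) \<in> (insert (w, snd d) (arcs g B))\<^sup>*))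
       = (\<Sum>d\<in>{d \<in> D. (snd d, w) \<notin> (arcs g B)\<^sup>*}. \<Sum>d'\<in>D. t d - (t d' + n d' * t d))"
      using disj wv by (intro sum.cong refl) (auto simp: rtrancl_insert t_def n_def)
    also have "\<dots> = (\<Sum>d\<in>D. (1 - n d) * (\<Sum>d'\<in>D. t d - (t d' + n d' * t d)))"
      using finD by (intro sum.mono_neutral_cong_left) (auto simp: n_def)
    also have "\<dots> = (\<Sum>d\<in>D. card D * ((1 - n d) * t d) - (1 - n d) * sum t D - sum n D * ((1 - n d) * t d))"
      by (intro sum.cong refl)
         (simp add: sum_subtractf sum.distrib sum_distrib_right[symmetric] algebra_simps)
    \<comment> \<open>By \<open>nt\<close> the restriction on \<open>d\<close> is invisible in terms
      containing \<open>t d\<close>; it only lowers the coefficient of the middle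
      \<open>sum t D\<close> to \<open>card D - sum n D\<close>, and everything cancels.\<close>
    also have "\<dots> = card D * sum t D - (card D - sum n D) * sum t D - sum n D * sum t D"
      unfolding nt by (simp add: sum_subtractf sum_distrib_right[symmetric] sum_distrib_left[symmetric])
    finally show "(\<Sum>d\<in>{d \<in> D. (snd d, w) \<notin> (arcs g B)\<^sup>*}. \<Sum>d'\<in>D. 
          of_bool ((w, v) \<in> (insert (w, snd d) (arcs g B))\<^sup>*)
          - of_bool ((snd d', v) \<in> (insert (w, snd d) (arcs g B))\<^sup>*)) = (0 :: real)"
      by (simp add: algebra_simps)
  qed
  finally show ?thesis .
qed

section \<open>Dirichlet energy and Rayleigh monotonicity\<close>

text \<open>A non-loop edge occurs once in each direction, whence the factors 2 in the energy
  identities below; loops contribute zero energy.\<close>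

definition arrows :: "('v, 'e) mgraph \<Rightarrow> ('v \<times> 'e \<times> 'v) set" where
  "arrows G = Sigma (verts G) (darts G)"

lemma finite_arrows: "finite_mgraph G \<Longrightarrow> finite (arrows G)"
  by (auto simp: arrows_def finite_darts finite_mgraph_def)

text \<open>Summation by parts: reversing all arrows permutes \<open>arrows G\<close> and turns the
  part with \<open>y u\<close> into minus the part with \<open>y w\<close>.\<close>

lemma dirichlet_laplacian:
  fixes G :: "('v, 'e) mgraph" and x y :: "'v \<Rightarrow> real"
  assumes fin: "finite_mgraph G"
  shows "(\<Sum>(w, e, u)\<in>arrows G. (x w - x u) * (y w - y u)) = 2 * (\<Sum>w\<in>verts G. laplacian G x w * y w)"
proof -
  let ?s = "\<lambda>(w, e, u). (u, e, w)"
  have s: "?s ` arrows G = arrows G"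
  proof -
    have sub: "?s ` arrows G \<subseteq> arrows G"
      using darts_in_verts[OF fin] by (fastforce simp: arrows_def darts_def insert_commute)
    have "arrows G = ?s ` ?s ` arrows G" by (force simp: image_image)
    with sub show ?thesis by blast
  qed
  have L: "(\<Sum>(w, e, u)\<in>arrows G. (x w - x u) * y w) = (\<Sum>w\<in>verts G. laplacian G x w * y w)"
    unfolding laplacian_def sum_distrib_right arrows_def
    by (subst sum.Sigma) (use fin in \<open>auto simp: finite_darts finite_mgraph_def case_prod_unfold\<close>)
  have "(\<Sum>(w, e, u)\<in>arrows G. (x w - x u) * y u) = (\<Sum>(w, e, u)\<in>?s ` arrows G. (x w - x u) * y u)"
    by (simp only: s)
  also have "\<dots> = (\<Sum>(w, e, u)\<in>arrows G. (x u - x w) * y w)"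
    by (subst sum.reindex) (auto simp: inj_on_def case_prod_unfold)
  also have "\<dots> = - (\<Sum>(w, e, u)\<in>arrows G. (x w - x u) * y w)"
    unfolding sum_negf[symmetric] by (intro sum.cong refl) (auto simp: algebra_simps)
  finally have R: "(\<Sum>(w, e, u)\<in>arrows G. (x w - x u) * y u) = - (\<Sum>(w, e, u)\<in>arrows G. (x w - x u) * y w)" .
  have "(\<Sum>(w, e, u)\<in>arrows G. (x w - x u) * (y w - y u)) =
      (\<Sum>(w, e, u)\<in>arrows G. (x w - x u) * y w) - (\<Sum>(w, e, u)\<in>arrows G. (x w - x u) * y u)"
    unfolding sum_subtractf[symmetric] by (intro sum.cong refl) (auto simp: algebra_simps)
  then show ?thesis using L R by simp
qed

text \<open>\<open>x\<close> is harmonic off the roots and \<open>y\<close> vanishes on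
  \<open>A\<close>, so only the term at \<open>v\<close> survives summation by parts. Taking
  \<open>y = x\<close> gives the energy of the voltage itself.\<close>

lemma dirichlet_attached:
  fixes G :: "('v, 'e) mgraph" and y :: "'v \<Rightarrow> real"
  assumes fin: "finite_mgraph G" and v: "v \<in> verts G" "v \<notin> A" and y: "\<And>a. a \<in> A \<Longrightarrow> y a = 0"
  defines "x \<equiv> attached G (insert v A) v"
  shows "(\<Sum>(w, e, u)\<in>arrows G. (x w - x u) * (y w - y u)) = 2 * (card (forests G A) * y v)"
proof -
  have "(\<Sum>w\<in>verts G. laplacian G x w * y w) = (\<Sum>w\<in>{v}. laplacian G x w * y w)"
  proof (rule sum.mono_neutral_right)
    show "\<forall>w\<in>verts G - {v}. laplacian G x w * y w = 0"
    proof
      fix w assume w: "w \<in> verts G - {v}"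
      show "laplacian G x w * y w = 0"
      proof (cases "w \<in> A")
        case True
        then show ?thesis using y by simp
      next
        case False
        then show ?thesis
          using laplacian_attached_other[OF fin, of w "insert v A" v] w by (simp add: x_def)
      qed
    qed
  qed (use fin v in \<open>auto simp: finite_mgraph_def\<close>)
  then show ?thesis
    using dirichlet_laplacian[OF fin, of x y] laplacian_attached_self[OF fin v] by (simp add: x_def)
qed

text \<open>The Dirichlet principle, by Cauchy-Schwarz between \<open>y\<close> and the voltage.
  Denominators are cleared because the forest counts may be zero.\<close>

lemma card_forests_dirichlet:
  fixes G :: "('v, 'e) mgraph" and y :: "'v \<Rightarrow> real"
  assumes fin: "finite_mgraph G" and v: "v \<in> verts G" "v \<notin> A" and y: "\<And>a. a \<in> A \<Longrightarrow> y a = 0"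
  shows "2 * (card (forests G A) * (y v)\<^sup>2) \<le>
    card (forests G (insert v A)) * (\<Sum>(w, e, u)\<in>arrows G. (y w - y u)\<^sup>2)"
proof (cases "card (forests G A) = 0")
  case True
  then show ?thesis by (auto intro!: mult_nonneg_nonneg sum_nonneg)
next
  case False
  define x where "x = attached G (insert v A) v"
  define m where "m = real (card (forests G A))"
  define n where "n = real (card (forests G (insert v A)))"
  define E where "E = (\<Sum>(w, e, u)\<in>arrows G. (y w - y u)\<^sup>2)"
  have x0: "\<And>a. a \<in> A \<Longrightarrow> x a = 0"
    using v by (auto simp: x_def intro!: attached_other_root)
  have "(\<Sum>(w, e, u)\<in>arrows G. (x w - x u) * (y w - y u))\<^sup>2 \<le>
      (\<Sum>(w, e, u)\<in>arrows G. (x w - x u)\<^sup>2) * E"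
    unfolding E_def case_prod_unfold by (rule Cauchy_Schwarz_ineq_sum)
  also have "(\<Sum>(w, e, u)\<in>arrows G. (x w - x u)\<^sup>2) = 2 * (m * n)"
    using dirichlet_attached[OF fin v, of x] x0
    by (simp add: x_def power2_eq_square m_def n_def attached_self)
  also have "(\<Sum>(w, e, u)\<in>arrows G. (x w - x u) * (y w - y u)) = 2 * (m * y v)"
    using dirichlet_attached[OF fin v, of y] y by (simp add: x_def m_def)
  finally have "(2 * m) * (2 * (m * (y v)\<^sup>2)) \<le> (2 * m) * (n * E)"
    by (simp add: power2_eq_square algebra_simps)
  moreover have "m > 0" using False by (simp add: m_def)
  ultimately show ?thesis unfolding m_def n_def E_def by (simp add: mult_le_cancel_left_pos)
qed

text \<open>The voltage on \<open>G\<close>, pulled back along \<phi>, is a test function for the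
  Dirichlet principle on \<open>H\<close>: it vanishes on \<open>B\<close> because \<phi> maps
  \<open>B\<close> into \<open>A\<close>. Its energy on \<open>H\<close> is at most that on
  \<open>G\<close>, since the arrows of the copy are among those of \<open>G\<close>.\<close>

lemma forests_rayleigh:
  assumes finG: "finite_mgraph G" and finH: "finite_mgraph H" and copy: "is_copy H G \<phi> \<psi>"
    and v: "v \<in> verts H" "v \<notin> B" "\<phi> v \<notin> A" and B: "\<phi> ` B \<subseteq> A"
  shows "card (forests H B) * card (forests G (insert (\<phi> v) A))
      \<le> card (forests H (insert v B)) * card (forests G A)"
proof -
  define x where "x = attached G (insert (\<phi> v) A) (\<phi> v)"
  define N where "N = real (card (forests G (insert (\<phi> v) A)))"
  define M where "M = real (card (forests G A))"
  have pv: "\<phi> v \<in> verts G" using copy v by (auto simp: is_copy_def)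
  have x0: "\<And>a. a \<in> A \<Longrightarrow> x a = 0"
    using v by (auto simp: x_def intro!: attached_other_root)
  have xv: "x (\<phi> v) = N" by (simp add: x_def N_def attached_self)
  let ?i = "\<lambda>(w, e, u). (\<phi> w, \<psi> e, \<phi> u)"
  have inj: "inj_on ?i (arrows H)"
  proof (rule inj_on_subset)
    show "inj_on ?i (verts H \<times> edges H \<times> verts H)"
      using copy by (auto simp: is_copy_def inj_on_def)
    show "arrows H \<subseteq> verts H \<times> edges H \<times> verts H"
      using darts_in_verts(2)[OF finH] by (fastforce simp: arrows_def darts_def)
  qed
  have sub: "?i ` arrows H \<subseteq> arrows G"
    using copy by (auto simp: is_copy_def arrows_def darts_def image_subset_iff)
  have "(\<Sum>(w, e, u)\<in>arrows H. (x (\<phi> w) - x (\<phi> u))\<^sup>2) = (\<Sum>(w, e, u)\<in>?i ` arrows H. (x w - x u)\<^sup>2)"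
    unfolding sum.reindex[OF inj] by (rule sum.cong) auto
  also have "\<dots> \<le> (\<Sum>(w, e, u)\<in>arrows G. (x w - x u)\<^sup>2)"
    by (rule sum_mono2[OF finite_arrows[OF finG] sub]) auto
  also have "\<dots> = 2 * (M * N)"
    using dirichlet_attached[OF finG pv v(3), of x] x0 xv
    by (simp add: x_def power2_eq_square M_def)
  finally have E: "(\<Sum>(w, e, u)\<in>arrows H. (x (\<phi> w) - x (\<phi> u))\<^sup>2) \<le> 2 * (M * N)" .
  have "2 * (card (forests H B) * (x (\<phi> v))\<^sup>2) \<le>
      card (forests H (insert v B)) * (\<Sum>(w, e, u)\<in>arrows H. (x (\<phi> w) - x (\<phi> u))\<^sup>2)"
    using card_forests_dirichlet[OF finH v(1,2), of "x \<circ> \<phi>"] x0 B by auto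
  also have "\<dots> \<le> card (forests H (insert v B)) * (2 * (M * N))"
    by (intro mult_left_mono E) simp
  finally have le: "N * (card (forests H B) * N) \<le> N * (card (forests H (insert v B)) * M)"
    by (simp add: xv power2_eq_square algebra_simps)
  have "card (forests H B) * N \<le> card (forests H (insert v B)) * M"
  proof (cases "N = 0")
    case True
    then show ?thesis by (simp add: M_def)
  next
    case False
    then have "N > 0" by (simp add: N_def)
    with le show ?thesis by (simp add: mult_le_cancel_left_pos)
  qed
  then have "real (card (forests H B) * card (forests G (insert (\<phi> v) A)))
      \<le> real (card (forests H (insert v B)) * card (forests G A))"
    by (simp add: N_def M_def)
  then show ?thesis by (simp only: of_nat_le_iff)
qed

text \<open>Hanging the root \<open>v\<close> on its neighbour \<open>a\<close> is injective and
  creates no cycle, because \<open>a\<close> is itself a root.\<close>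

lemma card_forests_insert_le:
  assumes fin: "finite_mgraph G" and v: "v \<in> verts G" "v \<notin> A" and a: "a \<in> A" "(e, a) \<in> darts G v"
  shows "card (forests G (insert v A)) \<le> card (forests G A)"
proof (rule card_inj_on_le)
  let ?f = "\<lambda>g. g(v := (e, a))"
  have B: "verts G - A = insert v (verts G - insert v A)" using v by auto
  show "?f ` forests G (insert v A) \<subseteq> forests G A"
  proof clarify
    fix g assume g: "g \<in> forests G (insert v A)"
    have "(a, v) \<notin> (arcs g (verts G - insert v A))\<^sup>*"
      using arcs_rtrancl_root[of a "verts G - insert v A" v g] a v by auto
    then have "acyclic (arcs (g(v := (e, a))) (insert v (verts G - insert v A)))"
      using g by (subst arcs_upd) (auto simp: acyclic_insert forests_def)
    moreover have "g(v := (e, a)) \<in> PiE (insert v (verts G - insert v A)) (darts G)"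
      using g a by (intro PiE_fun_upd) (auto simp: forests_def)
    ultimately show "g(v := (e, a)) \<in> forests G A"
      by (simp only: forests_def B mem_Collect_eq)
  qed
  show "inj_on ?f (forests G (insert v A))"
  proof (rule inj_onI)
    fix g g' assume g: "g \<in> forests G (insert v A)" "g' \<in> forests G (insert v A)"
      and eq: "g(v := (e, a)) = g'(v := (e, a))"
    have "g v = undefined" "g' v = undefined" using g by (auto simp: forests_def)
    then have gv: "g v = g' v" by simp
    show "g = g'"
    proof
      fix z show "g z = g' z" using gv fun_cong[OF eq, of z] by (cases "z = v") auto
    qed
  qed
qed (rule finite_forests[OF fin])


section \<open>Spanning trees as forests with a single root\<close>

definition forest_edges :: "('v, 'e) mgraph \<Rightarrow> 'v set \<Rightarrow> ('v \<Rightarrow> 'e \<times> 'v) \<Rightarrow> 'e set" where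
  "forest_edges G A p = (\<lambda>w. fst (p w)) ` (verts G - A)"

lemma forestsD:
  assumes "p \<in> forests G A" "w \<in> verts G" "w \<notin> A"
  shows "fst (p w) \<in> edges G" "ends G (fst (p w)) = {w, snd (p w)}"
proof -
  have "p w \<in> darts G w" using assms by (auto simp: forests_def)
  then show "fst (p w) \<in> edges G" "ends G (fst (p w)) = {w, snd (p w)}"
    by (auto simp: darts_def)
qed

text \<open>By finiteness and acyclicity, following parents must stop, and it can stop only at a
  root.\<close>

lemma forests_reach_root:
  assumes fin: "finite_mgraph G" and p: "p \<in> forests G A" and w: "w \<in> verts G"
  shows "\<exists>a \<in> verts G \<inter> A. (w, a) \<in> (arcs p (verts G - A))\<^sup>*"
proof -
  let ?R = "arcs p (verts G - A)"
  have "finite ?R" using fin by (auto simp: arcs_def finite_mgraph_def)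
  then have "wf (?R\<inverse>)"
    using p by (intro finite_acyclic_wf_converse) (auto simp: forests_def)
  then show ?thesis using w
  proof (induction w rule: wf_induct_rule)
    case (less w)
    show ?case
    proof (cases "w \<in> A")
      case True
      then show ?thesis using less.prems by auto
    next
      case False
      then have R: "(w, snd (p w)) \<in> ?R" using less.prems by (auto simp: arcs_def)
      have "p w \<in> darts G w" using p less.prems False by (auto simp: forests_def)
      then have "snd (p w) \<in> verts G" using darts_in_verts[OF fin] by blast
      with less.IH[of "snd (p w)"] R obtain a where
        "a \<in> verts G \<inter> A" "(snd (p w), a) \<in> ?R\<^sup>*" by auto
      with R show ?thesis by (meson converse_rtrancl_into_rtrancl)
    qed
  qed
qed

lemma connected_with_forest_edges:
  assumes fin: "finite_mgraph G" and p: "p \<in> forests G {r}" and r: "r \<in> verts G"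
    and sub: "forest_edges G {r} p \<subseteq> F"
  shows "connected_with G F"
  unfolding connected_with_def
proof (intro conjI ballI)
  show "verts G \<noteq> {}" using r by auto
  have sym: "symp (adj_in G F)" by (auto simp: symp_def adj_in_def)
  have adj: "adj_in G F x y" if "(x, y) \<in> arcs p (verts G - {r})" for x y
  proof -
    from that have x: "x \<in> verts G" "x \<notin> {r}" "y = snd (p x)" by (auto simp: arcs_def)
    then have "fst (p x) \<in> F" using sub by (auto simp: forest_edges_def)
    then show ?thesis using forestsD(2)[OF p x(1,2)] x(3) by (auto simp: adj_in_def)
  qed
  have to_root: "(adj_in G F)\<^sup>*\<^sup>* w r" if "w \<in> verts G" for w
  proof -
    have "(w, r) \<in> (arcs p (verts G - {r}))\<^sup>*"
      using forests_reach_root[OF fin p that] by auto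
    then show ?thesis
      by (induction rule: rtrancl_induct) (auto intro: rtranclp.rtrancl_into_rtrancl adj)
  qed
  fix u v assume "u \<in> verts G" "v \<in> verts G"
  then show "(adj_in G F)\<^sup>*\<^sup>* u v"
    using to_root sympD[OF symp_rtranclp[OF sym]] by (meson rtranclp_trans)
qed

lemma adj_in_dart:
  assumes fin: "finite_mgraph G" and F: "F \<subseteq> edges G" and adj: "adj_in G F w u" and ne: "u \<noteq> w"
  obtains e where "e \<in> F" "(e, u) \<in> darts G w"
proof -
  from adj obtain e where e: "e \<in> F" "w \<in> ends G e" "u \<in> ends G e"
    by (auto simp: adj_in_def)
  then have fe: "finite (ends G e)" "card (ends G e) \<le> 2"
    using F fin by (auto simp: finite_mgraph_def intro: finite_subset)
  have "{w, u} = ends G e"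
    using e fe ne by (intro card_seteq) auto
  then show ?thesis using e F by (intro that[of e]) (auto simp: darts_def)
qed

text \<open>A breadth-first tree: each vertex picks a dart in \<open>F\<close> to a vertex closer to
  \<open>r\<close>, so the distance falls along arcs and no cycle arises.\<close>

lemma forest_in_connected:
  fixes G :: "('v, 'e) mgraph"
  assumes fin: "finite_mgraph G" and con: "connected_with G F" and F: "F \<subseteq> edges G"
    and r: "r \<in> verts G"
  obtains p where "p \<in> forests G {r}" "forest_edges G {r} p \<subseteq> F"
proof -
  define dist where "dist = (\<lambda>w. LEAST n. (adj_in G F ^^ n) w r)"
  have reach: "(adj_in G F ^^ dist w) w r" if "w \<in> verts G" for w
  proof -
    have "(adj_in G F)\<^sup>*\<^sup>* w r" using con that r by (auto simp: connected_with_def)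
    then have "\<exists>n. (adj_in G F ^^ n) w r" by (simp add: rtranclp_power)
    then show ?thesis unfolding dist_def by (rule LeastI_ex)
  qed
  have "\<exists>d. d \<in> darts G w \<and> fst d \<in> F \<and> dist (snd d) < dist w" if w: "w \<in> verts G - {r}" for w
  proof (cases "dist w")
    case 0
    then show ?thesis using reach[of w] w by simp
  next
    case (Suc k)
    then have "(adj_in G F ^^ Suc k) w r" using reach[of w] w by simp
    then obtain u where u: "adj_in G F w u" "(adj_in G F ^^ k) u r"
      by (metis relpowp_Suc_E2)
    have "dist u \<le> k" unfolding dist_def using u(2) by (rule Least_le)
    then have less: "dist u < dist w" using Suc by simp
    then have "u \<noteq> w" by auto
    with u(1) obtain e where "e \<in> F" "(e, u) \<in> darts G w"
      using adj_in_dart[OF fin F] by metis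
    with less show ?thesis by (intro exI[of _ "(e, u)"]) auto
  qed
  then obtain q where q: "\<And>w. w \<in> verts G - {r} \<Longrightarrow>
      q w \<in> darts G w \<and> fst (q w) \<in> F \<and> dist (snd (q w)) < dist w"
    by metis
  define p where "p = restrict q (verts G - {r})"
  have "arcs p (verts G - {r}) \<subseteq> (measure dist)\<inverse>"
  proof
    fix z assume "z \<in> arcs p (verts G - {r})"
    then obtain x where x: "x \<in> verts G - {r}" "z = (x, snd (p x))" by (auto simp: arcs_def)
    then show "z \<in> (measure dist)\<inverse>" using q[OF x(1)] by (simp add: p_def)
  qed
  then have "acyclic (arcs p (verts G - {r}))"
    by (rule acyclic_subset[rotated]) (simp add: wf_acyclic)
  moreover have "p \<in> PiE (verts G - {r}) (darts G)"
    using q by (auto simp: p_def)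
  ultimately have "p \<in> forests G {r}" by (simp add: forests_def)
  moreover have "forest_edges G {r} p \<subseteq> F"
    using q by (auto simp: forest_edges_def p_def)
  ultimately show ?thesis by (rule that)
qed

lemma forests_no_2cycle:
  assumes "p \<in> forests G A" "w \<in> verts G - A" "u \<in> verts G - A" "snd (p w) = u" "snd (p u) = w"
  shows False
proof -
  have "(w, u) \<in> arcs p (verts G - A)" "(u, w) \<in> arcs p (verts G - A)"
    using assms by (auto simp: arcs_def)
  then have "(w, w) \<in> (arcs p (verts G - A))\<^sup>+" by (meson trancl.intros)
  then show False using assms(1) by (auto simp: forests_def acyclic_def)
qed

text \<open>If two vertices used the same edge to their parents, each would be the parent of the
  other.\<close>

lemma card_forest_edges:
  assumes p: "p \<in> forests G A"
  shows "card (forest_edges G A p) = card (verts G - A)"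
  unfolding forest_edges_def
proof (rule card_image, rule inj_onI)
  fix w w' assume w: "w \<in> verts G - A" "w' \<in> verts G - A" and eq: "fst (p w) = fst (p w')"
  have "{w, snd (p w)} = {w', snd (p w')}"
    using forestsD(2)[OF p, of w] forestsD(2)[OF p, of w'] w eq by auto
  then show "w = w'"
    using forests_no_2cycle[OF p w] by (auto simp: doubleton_eq_iff)
qed

text \<open>Minimality by counting: if an edge could be dropped, what is left would contain another
  forest rooted at \<open>r\<close>, with equally many edges.\<close>

lemma spanning_tree_forest_edges:
  assumes fin: "finite_mgraph G" and p: "p \<in> forests G {r}" and r: "r \<in> verts G"
  shows "spanning_tree G (forest_edges G {r} p)"
  unfolding spanning_tree_def
proof (intro conjI ballI notI)
  let ?T = "forest_edges G {r} p"
  show T: "?T \<subseteq> edges G" using forestsD(1)[OF p] by (auto simp: forest_edges_def)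
  show "connected_with G ?T" using connected_with_forest_edges[OF fin p r] by simp
  fix e assume e: "e \<in> ?T" and con: "connected_with G (?T - {e})"
  obtain q where q: "q \<in> forests G {r}" "forest_edges G {r} q \<subseteq> ?T - {e}"
    using forest_in_connected[OF fin con _ r] T by blast
  have "finite ?T" using T fin by (auto simp: finite_mgraph_def intro: finite_subset)
  then have "card (forest_edges G {r} q) < card ?T"
    using q(2) e by (intro psubset_card_mono) auto
  then show False by (simp add: card_forest_edges[OF p] card_forest_edges[OF q(1)])
qed

text \<open>If p and q orient the same tree differently at w, then they also differ at the p-parent of w,
  and so on all the way to the root, which has no parent.\<close>

lemma inj_on_forest_edges:
  assumes fin: "finite_mgraph G"
  shows "inj_on (forest_edges G {r}) (forests G {r})"
proof (rule inj_onI)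
  fix p q assume p: "p \<in> forests G {r}" and q: "q \<in> forests G {r}"
    and eq: "forest_edges G {r} p = forest_edges G {r} q"
  have next_differs: "snd (p w) \<noteq> r \<and> p (snd (p w)) \<noteq> q (snd (p w))"
    if w: "w \<in> verts G" "w \<noteq> r" and ne: "p w \<noteq> q w" for w
  proof -
    define e u where "e = fst (p w)" and "u = snd (p w)"
    have e: "ends G e = {w, u}"
      using forestsD(2)[OF p, of w] w by (simp add: e_def u_def)
    have "e \<in> forest_edges G {r} q"
      unfolding eq[symmetric] using w by (auto simp: forest_edges_def e_def)
    then obtain x where x: "x \<in> verts G" "x \<noteq> r" "fst (q x) = e"
      by (auto simp: forest_edges_def)
    have ex: "{w, u} = {x, snd (q x)}"
      using forestsD(2)[OF q, of x] x e by simp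
    have "x \<noteq> w"
    proof
      assume "x = w"
      with ex x have "q w = (e, u)" by (auto simp: doubleton_eq_iff prod_eq_iff)
      with ne show False by (simp add: e_def u_def)
    qed
    with ex have xu: "x = u" "snd (q u) = w" by (auto simp: doubleton_eq_iff)
    have "p u \<noteq> q u"
    proof
      assume "p u = q u"
      then show False
        using forests_no_2cycle[OF p, of w u] w x(1,2) xu by (simp add: u_def[symmetric])
    qed
    then show ?thesis using x(2) xu(1) by (simp add: u_def[symmetric])
  qed
  have eq_at: "p w = q w" if w: "w \<in> verts G" "w \<noteq> r" for w
  proof (rule ccontr)
    assume ne: "p w \<noteq> q w"
    have "z \<noteq> r \<and> p z \<noteq> q z" if "(w, z) \<in> (arcs p (verts G - {r}))\<^sup>*" for z
      using that
    proof (induction rule: rtrancl_induct)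
      case base
      then show ?case using w ne by simp
    next
      case (step y z)
      then show ?case using next_differs[of y] by (auto simp: arcs_def)
    qed
    then show False
      using forests_reach_root[OF fin p w(1)] by blast
  qed
  have "p \<in> PiE (verts G - {r}) (darts G)" "q \<in> PiE (verts G - {r}) (darts G)"
    using p q by (simp_all add: forests_def)
  then show "p = q" by (rule PiE_ext) (use eq_at in simp)
qed

text \<open>A spanning tree contains the edges of a forest rooted at \<open>r\<close>, and these
  already connect \<open>G\<close>, so minimality forces equality. The count is thus the same for
  every root \<open>r\<close>.\<close>

lemma tau_eq_card_forests:
  assumes fin: "finite_mgraph G" and r: "r \<in> verts G"
  shows "tau G = card (forests G {r})"
proof -
  have "{T. spanning_tree G T} = forest_edges G {r} ` forests G {r}"
  proof (intro equalityI subsetI)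
    fix T assume "T \<in> {T. spanning_tree G T}"
    then have T: "T \<subseteq> edges G" "connected_with G T"
      and min: "\<And>e. e \<in> T \<Longrightarrow> \<not> connected_with G (T - {e})"
      by (auto simp: spanning_tree_def)
    obtain p where p: "p \<in> forests G {r}" "forest_edges G {r} p \<subseteq> T"
      using forest_in_connected[OF fin T(2,1) r] .
    have "T \<subseteq> forest_edges G {r} p"
    proof
      fix e assume e: "e \<in> T"
      show "e \<in> forest_edges G {r} p"
      proof (rule ccontr)
        assume "e \<notin> forest_edges G {r} p"
        then have "connected_with G (T - {e})"
          using connected_with_forest_edges[OF fin p(1) r, of "T - {e}"] p(2) by auto
        then show False using min[OF e] by simp
      qed
    qed
    with p show "T \<in> forest_edges G {r} ` forests G {r}" by auto
  qed (use spanning_tree_forest_edges[OF fin _ r] in auto)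
  then show ?thesis
    unfolding tau_def by (simp add: card_image inj_on_forest_edges[OF fin])
qed


section \<open>Shrinking the root set in all copies at once\<close>

lemma rtranclp_crossing:
  assumes "r\<^sup>*\<^sup>* x y" "x \<notin> A" "y \<in> A"
  shows "\<exists>u v. r u v \<and> u \<notin> A \<and> v \<in> A"
  using assms by (induction rule: rtranclp_induct) auto

lemma connected_boundary_dart:
  assumes con: "connected_mgraph G" and A: "A \<subset> verts G" "A \<noteq> {}"
  obtains v a e where "v \<in> verts G" "v \<notin> A" "a \<in> A" "(e, a) \<in> darts G v"
proof -
  have fin: "finite_mgraph G" using con by (simp add: connected_mgraph_def)
  obtain x y where xy: "x \<in> verts G" "x \<notin> A" "y \<in> A" "y \<in> verts G" using A by blast
  then have "(adj_in G (edges G))\<^sup>*\<^sup>* x y"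
    using con by (auto simp: connected_mgraph_def connected_with_def)
  from rtranclp_crossing[OF this xy(2,3)]
  obtain v a where va: "adj_in G (edges G) v a" "v \<notin> A" "a \<in> A" by blast
  then have "a \<noteq> v" by auto
  then obtain e where e: "(e, a) \<in> darts G v"
    using adj_in_dart[OF fin subset_refl va(1)] by auto
  show ?thesis by (rule that[OF darts_in_verts(1)[OF fin e] va(2,3) e])
qed

lemma forests_all_roots: "forests G (verts G) = {\<lambda>_. undefined}"
  by (auto simp: forests_def arcs_def acyclic_def)

text \<open>The bound is proved for every nonempty root set \<open>A\<close> by induction on the
  number of non-roots. At \<open>A = {r}\<close> each copy contains at most one root, so every
  factor is \<open>tau H\<close>.\<close>

lemma tau_power_le_of_uniform_cover:
  fixes G :: "('v, 'e) mgraph" and H :: "('w, 'f) mgraph"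
  assumes G: "connected_mgraph G" and H: "connected_mgraph H"
    and I: "finite I" and copy: "\<And>i. i \<in> I \<Longrightarrow> is_copy H G (\<phi> i) (\<psi> i)"
    and cover: "\<And>v. v \<in> verts G \<Longrightarrow> card {i \<in> I. v \<in> \<phi> i ` verts H} = c"
  shows "tau H ^ card I \<le> tau G ^ c" and "tau G \<ge> 1"
proof -
  have fin: "finite_mgraph G" "finite_mgraph H" and ne: "verts G \<noteq> {}" "verts H \<noteq> {}"
    using G H by (auto simp: connected_mgraph_def connected_with_def)
  define B where "B = (\<lambda>i A. {x \<in> verts H. \<phi> i x \<in> A})"
  \<comment> \<open>With no root at all there are no forests in \<open>H\<close>. The default
    \<open>tau H\<close> is the count for a single root, so losing the last root leaves the factor
    unchanged.\<close>
  define g where "g = (\<lambda>i A. if B i A = {} then tau H else card (forests H (B i A)))"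
  \<comment> \<open>Positivity is carried along so that \<open>N ^ c\<close> can be cancelled in the
    induction step.\<close>
  have main: "1 \<le> card (forests G A) \<and> (\<Prod>i\<in>I. g i A) \<le> card (forests G A) ^ c"
    if "A \<subseteq> verts G" "A \<noteq> {}" for A
    using that
  proof (induction "card (verts G - A)" arbitrary: A rule: less_induct)
    case less
    show ?case
    proof (cases "A = verts G")
      case True
      have "g i A = 1" if "i \<in> I" for i
      proof -
        have "B i A = verts H" using copy[OF that] True by (auto simp: B_def is_copy_def)
        then show ?thesis using ne by (simp add: g_def forests_all_roots)
      qed
      then show ?thesis using True by (simp add: forests_all_roots)
    next
      case False
      then obtain v a e where v: "v \<in> verts G" "v \<notin> A" and a: "a \<in> A" "(e, a) \<in> darts G v"
        using connected_boundary_dart[OF G, of A] less.prems by blast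
      define M N where "M = card (forests G A)" and "N = card (forests G (insert v A))"
      have "card (verts G - insert v A) < card (verts G - A)"
        using v fin by (intro psubset_card_mono) (auto simp: finite_mgraph_def)
      then have IH: "1 \<le> N" "(\<Prod>i\<in>I. g i (insert v A)) \<le> N ^ c"
        using less.hyps[of "insert v A"] less.prems v by (auto simp: N_def)
      have NM: "N \<le> M"
        unfolding N_def M_def by (rule card_forests_insert_le[OF fin(1) v a])
      have step: "g i A * (if v \<in> \<phi> i ` verts H then N else 1)
          \<le> g i (insert v A) * (if v \<in> \<phi> i ` verts H then M else 1)" if i: "i \<in> I" for i
      proof (cases "v \<in> \<phi> i ` verts H")
        case False
        then have "B i (insert v A) = B i A" by (auto simp: B_def)
        then show ?thesis using False by (simp add: g_def)
      next
        case True
        then obtain x where x: "x \<in> verts H" "v = \<phi> i x" by auto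
        have Bx: "B i (insert v A) = insert x (B i A)"
          using copy[OF i] x by (auto simp: B_def is_copy_def inj_on_def)
        have "g i A * N \<le> g i (insert v A) * M"
        proof (cases "B i A = {}")
          \<comment> \<open>Here \<open>v\<close> was the last root of the copy;
            \<open>N \<le> M\<close>, which came from the adjacency of \<open>v\<close> to
            \<open>A\<close>, suffices.\<close>
          case True
          then have "g i A = tau H" "g i (insert v A) = tau H"
            using tau_eq_card_forests[OF fin(2) x(1)] by (simp_all add: g_def Bx)
          then show ?thesis using NM by simp
        next
          case False
          have "card (forests H (B i A)) * N \<le> card (forests H (insert x (B i A))) * M"
            unfolding N_def M_def x(2)
            by (rule forests_rayleigh[OF fin copy[OF i] x(1)]) (use v x in \<open>auto simp: B_def\<close>)
          then show ?thesis using False by (simp add: g_def Bx)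
        qed
        then show ?thesis using True by simp
      qed
      \<comment> \<open>Exactly \<open>c\<close> copies contain \<open>v\<close>, so multiplying
        \<open>step\<close> over all copies produces \<open>N ^ c\<close> and
        \<open>M ^ c\<close>.\<close>
      have pw: "(\<Prod>i\<in>I. if v \<in> \<phi> i ` verts H then n else 1) = n ^ c" for n :: nat
        using cover[OF v(1)] I by (simp add: prod.inter_filter[symmetric])
      have "(\<Prod>i\<in>I. g i A) * N ^ c \<le> (\<Prod>i\<in>I. g i (insert v A)) * M ^ c"
        unfolding pw[symmetric] prod.distrib[symmetric] by (rule prod_mono) (use step in simp)
      also have "\<dots> \<le> N ^ c * M ^ c" using IH(2) by simp
      finally have "(\<Prod>i\<in>I. g i A) \<le> M ^ c" using IH(1) by (simp add: mult.commute)
      then show ?thesis using IH(1) NM by (simp add: M_def)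
    qed
  qed
  obtain r where r: "r \<in> verts G" using ne by blast
  have "g i {r} = tau H" if i: "i \<in> I" for i
  proof (cases "B i {r} = {}")
    case False
    then obtain x where "x \<in> verts H" "\<phi> i x = r" by (auto simp: B_def)
    then have "x \<in> verts H" "B i {r} = {x}"
      using copy[OF i] by (auto simp: B_def is_copy_def inj_on_def)
    then show ?thesis using tau_eq_card_forests[OF fin(2), of x] by (simp add: g_def)
  qed (simp add: g_def)
  then show "tau H ^ card I \<le> tau G ^ c" "tau G \<ge> 1"
    using main[of "{r}"] r tau_eq_card_forests[OF fin(1) r] by simp_all
qed

section \<open>Double counting and comparison of exponents\<close>

theorem theorem3p6:
  fixes G :: "('v, 'e) mgraph" and H :: "('w, 'f) mgraph"
  assumes "connected_mgraph G" and "connected_mgraph H"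
    and "fractionally_tiles H G"
  shows "real (tau G) powr (1 / real (card (verts G))) \<ge> real (tau H) powr (1 / real (card (verts H)))"
proof -
  have fin: "finite (verts G)" "finite (verts H)" and ne: "verts G \<noteq> {}" "verts H \<noteq> {}"
    using assms by (auto simp: connected_mgraph_def connected_with_def finite_mgraph_def)
  obtain cs :: "(('w \<Rightarrow> 'v) \<times> ('f \<Rightarrow> 'e)) list" and c where cs: "cs \<noteq> []"
    and copies: "\<forall>(\<phi>, \<psi>) \<in> set cs. is_copy H G \<phi> \<psi>"
    and c: "\<forall>v \<in> verts G. length (filter (\<lambda>(\<phi>, \<psi>). v \<in> \<phi> ` verts H) cs) = c"
    using assms(3) unfolding fractionally_tiles_def by blast
  define \<phi> where "\<phi> = (\<lambda>i. fst (cs ! i))"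
  define m n h where "m = length cs" and "n = card (verts G)" and "h = card (verts H)"
  have copy: "is_copy H G (\<phi> i) (snd (cs ! i))" if "i < m" for i
    using copies nth_mem[of i cs] that by (auto simp: \<phi>_def m_def case_prod_unfold)
  have cover: "card {i \<in> {..<m}. v \<in> \<phi> i ` verts H} = c" if "v \<in> verts G" for v
    using c that by (auto simp: length_filter_conv_card \<phi>_def m_def case_prod_unfold)
  have le: "tau H ^ m \<le> tau G ^ c" and G1: "tau G \<ge> 1"
    using tau_power_le_of_uniform_cover[OF assms(1,2), of "{..<m}" \<phi> "\<lambda>i. snd (cs ! i)" c]
      copy cover by simp_all
  \<comment> \<open>Pairs of a vertex and a copy containing it are counted in two ways.\<close>
  have "n * c = (\<Sum>v\<in>verts G. card {i \<in> {..<m}. v \<in> \<phi> i ` verts H})"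
    using cover by (simp add: n_def)
  also have "\<dots> = (\<Sum>v\<in>verts G. \<Sum>i<m. of_bool (v \<in> \<phi> i ` verts H))"
    by (simp add: Int_def)
  also have "\<dots> = (\<Sum>i<m. \<Sum>v\<in>verts G. of_bool (v \<in> \<phi> i ` verts H))"
    by (rule sum.swap)
  also have "\<dots> = (\<Sum>i<m. h)"
  proof (rule sum.cong[OF refl])
    fix i assume "i \<in> {..<m}"
    then have i: "inj_on (\<phi> i) (verts H)" "\<phi> i ` verts H \<subseteq> verts G"
      using copy[of i] by (auto simp: is_copy_def)
    have "(\<Sum>v\<in>verts G. of_bool (v \<in> \<phi> i ` verts H)) = card (verts G \<inter> \<phi> i ` verts H)"
      using fin by simp
    also have "verts G \<inter> \<phi> i ` verts H = \<phi> i ` verts H" using i(2) by blast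
    finally show "(\<Sum>v\<in>verts G. of_bool (v \<in> \<phi> i ` verts H)) = h"
      using card_image[OF i(1)] by (simp add: h_def)
  qed
  finally have nc: "n * c = m * h" by simp
  have pos: "m > 0" "n > 0" "h > 0"
    using cs fin ne by (auto simp: m_def n_def h_def card_gt_0_iff)
  then have "c > 0" using nc by (cases c) auto
  \<comment> \<open>Since \<open>m * h = n * c\<close>, raising \<open>le\<close> to the single
    power \<open>1 / (m * h)\<close> yields both desired exponents.\<close>
  have exponents: "real m * (1 / real (m * h)) = 1 / real h" "real c * (1 / real (m * h)) = 1 / real n"
    using pos \<open>c > 0\<close> arg_cong[OF nc, of real] by (simp_all add: field_simps)
  \<comment> \<open>For \<open>t = 0\<close> this needs \<open>k > 0\<close>: \<open>0 ^ 0\<close>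
    is 1, whereas \<open>0 powr x\<close> is always 0.\<close>
  have powr_eq: "real t powr (real k * x) = real (t ^ k) powr x" if "k > 0" for t k x
    using that by (cases "t = 0") (simp_all add: powr_powr[symmetric] powr_realpow)
  have "real (tau H) powr (1 / real h) = real (tau H ^ m) powr (1 / real (m * h))"
    unfolding exponents(1)[symmetric] using pos(1) by (rule powr_eq)
  also have "\<dots> \<le> real (tau G ^ c) powr (1 / real (m * h))"
    using le by (intro powr_mono2) (simp_all del: of_nat_power)
  also have "\<dots> = real (tau G) powr (1 / real n)"
    unfolding exponents(2)[symmetric] using \<open>c > 0\<close> by (rule powr_eq[symmetric])
  finally show ?thesis by (simp add: n_def h_def)
qed

end
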